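(* Let $F$ be the distribution function of a probability measure on $[0,\infty)$ with finite mean, and let $u>0$, $r>0$. Let $\varphi:\mathbb{R}^2\to[0,\infty)$ be the random field built from the marked Poisson line process of intensity $u$, cylinders of base-radius $r$ and value distribution $F$, as described in the context, and let $\mathcal{O}$ be the occupied set of Gilbert's disc model with geostatistical marking by $\varphi$. Then for every $\lambda>0$, $$\mathbf{P}_\lambda(0\in\mathcal{O})<1.$$
   Context: The field: for $(\theta,t)\in[0,2\pi)\times[0,\infty)$ let $\ell_\theta$ be the half-line from the origin at angle $\theta$ with the first coordinate axis, and let $\ell(\theta,t)$ be the line perpendicular to $\ell_\theta$ meeting $\ell_\theta$ at distance $t$ from the origin. Let $X$ be a homogeneous Poisson point process on $[0,2\pi)\times[0,\infty)\times[0,1]$ with intensity $u$, and $Y=\{(\ell(\theta,t),z):(\theta,t,z)\in X\}$ the resulting marked Poisson line process. For a line $\ell$ let $C(\ell)$ be the closed set of points at Euclidean distance at most $r$ from $\ell$, and $\mathcal{L}=\bigcup_{(\ell,z)\in Y}C(\ell)$. Put $F^{-1}(z)=\inf\{x\in\mathbb{R}:F(x)\ge z\}$. Then $\varphi(x)=0$ if $x\notin\mathcal{L}$, and $\varphi(x)=\inf\{F^{-1}(z):(\ell,z)\in Y,\ x\in C(\ell)\}$ if $x\in\mathcal{L}$. The model: $\eta$ is a homogeneous Poisson point process on $\mathbb{R}^2$ with intensity $\lambda$, independent of $\varphi$; $\mathbf{P}_\lambda$ is the joint law of $(\eta,\varphi)$; $\mathcal{O}=\bigcup_{x\in\eta}B(x,\varphi(x))$,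 with $B(x,r)$ the closed Euclidean disc of radius $r$ centred at $x$. *)

theory Defs
  imports "HOL-Probability.Probability"
begin

section \<open>Poisson point processes\<close>

text \<open>
  A point process is a random locally finite set. All intensity measures used here are
  diffuse, so multiple points occur with probability zero and no multiplicities are recorded.
  It suffices to constrain the counts of bounded measurable sets; finite disjoint families are
  covered by padding the sequence with empty sets. The Poisson weights are written out so that
  the formula also covers mean zero, where the count is almost surely zero.
\<close>

definition poisson_process ::
    "'w measure \<Rightarrow> 'a::euclidean_space measure \<Rightarrow> ('w \<Rightarrow> 'a set) \<Rightarrow> bool" where
  "poisson_process M \<Lambda> N \<longleftrightarrow>
     (\<forall>\<omega>\<in>space M. N \<omega> \<subseteq> space \<Lambda> \<and> (\<forall>B. bounded B \<longrightarrow> finite (N \<omega> \<inter> B))) \<and>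
     (\<forall>A\<in>sets \<Lambda>. bounded A \<longrightarrow>
        (\<lambda>\<omega>. card (N \<omega> \<inter> A)) \<in> measurable M (count_space UNIV) \<and>
        (\<forall>k. measure M {\<omega> \<in> space M. card (N \<omega> \<inter> A) = k} =
             exp (- measure \<Lambda> A) * measure \<Lambda> A ^ k / fact k)) \<and>
     (\<forall>A :: nat \<Rightarrow> 'a set.
        disjoint_family A \<longrightarrow> (\<forall>i. A i \<in> sets \<Lambda> \<and> bounded (A i)) \<longrightarrow>
        prob_space.indep_vars M (\<lambda>_. count_space UNIV) (\<lambda>i \<omega>. card (N \<omega> \<inter> A i)) UNIV)"

definition homogeneous_poisson_process ::
    "'w measure \<Rightarrow> 'a::euclidean_space set \<Rightarrow> real \<Rightarrow> ('w \<Rightarrow> 'a set) \<Rightarrow> bool" where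
  "homogeneous_poisson_process M S c N \<longleftrightarrow>
     poisson_process M (scale_measure (ennreal c) (restrict_space lborel S)) N"

section \<open>The random field of marked Poisson cylinders\<close>

definition direction :: "real \<Rightarrow> real^2" where
  "direction \<theta> = vector [cos \<theta>, sin \<theta>]"

text \<open>The half-line at angle \<open>\<theta>\<close> consists of the points \<open>t *\<^sub>R direction \<theta>\<close> with \<open>t \<ge> 0\<close>.\<close>

definition perp_line :: "real \<Rightarrow> real \<Rightarrow> (real^2) set" where
  "perp_line \<theta> t = {y. orthogonal (y - t *\<^sub>R direction \<theta>) (direction \<theta>)}"

definition line_params :: "(real \<times> real \<times> real) set" where
  "line_params = {0..<2 * pi} \<times> {0..} \<times> {0..1}"

definition marked_lines :: "(real \<times> real \<times> real) set \<Rightarrow> ((real^2) set \<times> real) set" where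
  "marked_lines X = (\<lambda>(\<theta>, t, z). (perp_line \<theta> t, z)) ` X"

definition cyl :: "real \<Rightarrow> (real^2) set \<Rightarrow> (real^2) set" where
  "cyl r l = {x. infdist x l \<le> r}"

definition cyl_union :: "real \<Rightarrow> ((real^2) set \<times> real) set \<Rightarrow> (real^2) set" where
  "cyl_union r Y = (\<Union>(l, z)\<in>Y. cyl r l)"

text \<open>
  The infimum is taken in the extended reals: it is \<open>-\<infinity>\<close> for \<open>z = 0\<close>, and it may be
  \<open>\<infinity>\<close> for \<open>z = 1\<close>. Almost surely no line carries the mark 0 or 1.
\<close>

definition quantile :: "(real \<Rightarrow> real) \<Rightarrow> real \<Rightarrow> ereal" where
  "quantile F z = (INF x\<in>{x. F x \<ge> z}. ereal x)"

definition cyl_field ::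
    "(real \<Rightarrow> real) \<Rightarrow> real \<Rightarrow> ((real^2) set \<times> real) set \<Rightarrow> real^2 \<Rightarrow> ereal" where
  "cyl_field F r Y x =
     (if x \<in> cyl_union r Y then Inf {quantile F z | l z. (l, z) \<in> Y \<and> x \<in> cyl r l} else 0)"

section \<open>Gilbert's disc model with geostatistical marking\<close>

definition ereal_disc :: "real^2 \<Rightarrow> ereal \<Rightarrow> (real^2) set" where
  "ereal_disc x \<rho> = {y. ereal (dist x y) \<le> \<rho>}"

definition occupied :: "(real^2) set \<Rightarrow> (real^2 \<Rightarrow> ereal) \<Rightarrow> (real^2) set" where
  "occupied H \<phi> = (\<Union>x\<in>H. ereal_disc x (\<phi> x))"

text \<open>
  Independence of a planar point process and a random field: a point process is identified with
  the family of its counts in bounded Borel sets, a field with the family of its values.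
  The two generated sigma-algebras are required to be independent.
\<close>

definition indep_process_field ::
    "'w measure \<Rightarrow> ('w \<Rightarrow> (real^2) set) \<Rightarrow> ('w \<Rightarrow> real^2 \<Rightarrow> ereal) \<Rightarrow> bool" where
  "indep_process_field M \<eta> \<phi> \<longleftrightarrow>
     prob_space.indep_set M
       (sets (vimage_algebra (space M)
          (\<lambda>\<omega>. \<lambda>A\<in>{A \<in> sets borel. bounded A}. card (\<eta> \<omega> \<inter> A))
          (\<Pi>\<^sub>M A\<in>{A \<in> sets borel. bounded A}. count_space UNIV)))
       (sets (vimage_algebra (space M) \<phi> (\<Pi>\<^sub>M x\<in>UNIV. borel)))"

end

theory Submission imports Defs begin

text \<open>
  The set \<open>S\<close> of points \<open>x\<close> with \<open>\<bar>x\<bar> \<le> \<phi> x\<close> is almost surely bounded: by the finite mean and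
  Borel--Cantelli, only finitely many lines with value \<open>\<rho>\<close> come as close to the origin as
  \<open>t < 2 * \<rho> + r\<close>, and no other line reaches a point \<open>x\<close> with \<open>\<bar>x\<bar> < 2 * \<rho>\<close>. Hence \<open>S\<close> lies in some
  fixed ball with positive probability, and independently of \<open>\<phi>\<close> this ball contains no point of
  \<open>\<eta>\<close> with positive probability; then the origin is vacant.

  The sigma-algebra generated by \<open>\<phi>\<close> only sees countably many coordinates. The boundedness of
  \<open>S\<close> is therefore read off the inequality \<open>\<phi> y \<le> \<bar>y\<bar> / 2\<close> on a countable dense set, using
  that near every point of a cylinder there are dense points meeting no additional cylinder.
\<close>

section \<open>Geometry of the cylinders and lower bounds on the field\<close>

lemma direction_inner [simp]: "direction \<theta> \<bullet> direction \<theta> = 1"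
  by (simp add: direction_def inner_vec_def sum_2 vector_2 flip: power2_eq_square)

lemma norm_direction [simp]: "norm (direction \<theta>) = 1"
  by (simp add: norm_eq_sqrt_inner)

text \<open>The foot of the perpendicular attains the distance, and Cauchy-Schwarz against the unit
  normal shows that no point of the line is nearer.\<close>

lemma mem_cyl_perp_line: "x \<in> cyl r (perp_line \<theta> t) \<longleftrightarrow> \<bar>x \<bullet> direction \<theta> - t\<bar> \<le> r"
proof -
  let ?d = "direction \<theta>" and ?L = "perp_line \<theta> t"
  define y where "y = x - (x \<bullet> ?d - t) *\<^sub>R ?d"
  have y: "y \<in> ?L"
    by (simp add: y_def perp_line_def orthogonal_def inner_diff_left)
  have "infdist x ?L \<le> \<bar>x \<bullet> ?d - t\<bar>"
    using infdist_le[OF y, of x] by (simp add: y_def dist_norm)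
  moreover have "\<bar>x \<bullet> ?d - t\<bar> \<le> dist x w" if "w \<in> ?L" for w
  proof -
    have "x \<bullet> ?d - t = (x - w) \<bullet> ?d"
      using that by (simp add: perp_line_def orthogonal_def inner_diff_left)
    then show ?thesis
      using Cauchy_Schwarz_ineq2[of "x - w" ?d] by (simp add: dist_norm)
  qed
  then have "\<bar>x \<bullet> ?d - t\<bar> \<le> infdist x ?L"
    using y by (auto simp: infdist_def intro!: cINF_greatest)
  ultimately show ?thesis
    by (simp add: cyl_def)
qed

text \<open>A disc centred at \<open>x\<close> covers the origin iff \<open>norm x\<close> is a
  lower bound of the field at \<open>x\<close>, and a lower bound of an infimum is a condition on
  each line separately. The last branch comes from the value 0 off the cylinders.\<close>

lemma le_cyl_field_iff:
  "ereal s \<le> cyl_field F r (marked_lines X) x \<longleftrightarrow>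
     (if \<exists>(\<theta>, t, z)\<in>X. \<bar>x \<bullet> direction \<theta> - t\<bar> \<le> r
      then \<forall>(\<theta>, t, z)\<in>X. \<bar>x \<bullet> direction \<theta> - t\<bar> \<le> r \<longrightarrow> ereal s \<le> quantile F z
      else s \<le> 0)"
proof -
  have "x \<in> cyl_union r (marked_lines X) \<longleftrightarrow> (\<exists>(\<theta>, t, z)\<in>X. \<bar>x \<bullet> direction \<theta> - t\<bar> \<le> r)"
    by (auto simp: cyl_union_def marked_lines_def mem_cyl_perp_line split_beta)
  moreover have "{quantile F z | l z. (l, z) \<in> marked_lines X \<and> x \<in> cyl r l} =
      {quantile F z | \<theta> t z. (\<theta>, t, z) \<in> X \<and> \<bar>x \<bullet> direction \<theta> - t\<bar> \<le> r}" (is "?A = ?B")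
  proof -
    have "(\<exists>l. (l, z) \<in> marked_lines X \<and> x \<in> cyl r l) \<longleftrightarrow>
        (\<exists>\<theta> t. (\<theta>, t, z) \<in> X \<and> \<bar>x \<bullet> direction \<theta> - t\<bar> \<le> r)" for z
      by (force simp: marked_lines_def mem_cyl_perp_line)
    then show ?thesis
      by blast
  qed
  moreover have "ereal s \<le> Inf ?B \<longleftrightarrow>
      (\<forall>(\<theta>, t, z)\<in>X. \<bar>x \<bullet> direction \<theta> - t\<bar> \<le> r \<longrightarrow> ereal s \<le> quantile F z)"
    by (auto simp: le_Inf_iff)
  ultimately show ?thesis
    by (simp add: cyl_field_def)
qed

text \<open>Monotonicity lets a real witness be replaced by a larger rational below
  \<open>s\<close>; the quantifier becomes countable, which serves measurability in
  \<open>z\<close>.\<close>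

lemma quantile_less_iff:
  assumes "mono F"
  shows "quantile F z < ereal s \<longleftrightarrow> (\<exists>q. of_rat q < s \<and> z \<le> F (of_rat q))"
proof
  assume "quantile F z < ereal s"
  then obtain x where "x < s" "z \<le> F x"
    by (auto simp: quantile_def INF_less_iff)
  moreover obtain q where "x < of_rat q" "of_rat q < s"
    using of_rat_dense[OF \<open>x < s\<close>] by blast
  ultimately show "\<exists>q. of_rat q < s \<and> z \<le> F (of_rat q)"
    using monoD[OF assms, of x "of_rat q"] by force
qed (auto simp: quantile_def INF_less_iff)

section \<open>Measurability of existence statements about point processes\<close>

text \<open>The counted set varies with \<open>\<omega>\<close>, while \<open>cnt\<close> covers
  fixed sets. A Dynkin argument starting from rectangles bridges the gap: complements use that
  counts are finite, disjoint unions the additivity of counting measure.\<close>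

lemma borel_measurable_card_section:
  fixes N :: "'w \<Rightarrow> 'a set"
  assumes fin: "\<And>\<omega>. \<omega> \<in> space M \<Longrightarrow> finite (N \<omega>)"
    and sub: "\<And>\<omega>. \<omega> \<in> space M \<Longrightarrow> N \<omega> \<subseteq> space L"
    and cnt: "\<And>A. A \<in> sets L \<Longrightarrow> (\<lambda>\<omega>. card (N \<omega> \<inter> A)) \<in> measurable M (count_space UNIV)"
    and H: "H \<in> sets (M \<Otimes>\<^sub>M L)"
  shows "(\<lambda>\<omega>. of_nat (card {x \<in> N \<omega>. (\<omega>, x) \<in> H}) :: ennreal) \<in> borel_measurable M"
proof -
  define f where "f H \<omega> = (of_nat (card {x \<in> N \<omega>. (\<omega>, x) \<in> H}) :: ennreal)" for H \<omega>
  have cnt': "(\<lambda>\<omega>. of_nat (card (N \<omega> \<inter> A)) :: ennreal) \<in> borel_measurable M"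
    if "A \<in> sets L" for A
    by (rule measurable_compose[OF cnt[OF that]]) simp
  let ?G = "{a \<times> b | a b. a \<in> sets M \<and> b \<in> sets L}"
  have "?G \<subseteq> Pow (space M \<times> space L)" "H \<in> sigma_sets (space M \<times> space L) ?G"
    using H by (auto simp: sets_pair_measure dest: sets.sets_into_space)
  with Int_stable_pair_measure_generator[of M L] have "f H \<in> borel_measurable M"
  proof (induction rule: sigma_sets_induct_disjoint)
    case (basic A)
    then obtain a b where A: "A = a \<times> b" "a \<in> sets M" "b \<in> sets L"
      by auto
    have "f A \<omega> = of_nat (card (N \<omega> \<inter> b)) * indicator a \<omega>" for \<omega>
      by (auto simp: f_def A Int_def indicator_def)
    then show ?case
      using A cnt'[of b] by (simp add: f_def[abs_def])
  next
    case empty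
    then show ?case by (simp add: f_def[abs_def])
  next
    case (compl A)
    have "f (space M \<times> space L - A) \<omega> = of_nat (card (N \<omega> \<inter> space L)) - f A \<omega>"
      if "\<omega> \<in> space M" for \<omega>
    proof -
      have "card (N \<omega> \<inter> space L) =
          card {x \<in> N \<omega>. (\<omega>, x) \<in> space M \<times> space L - A} + card {x \<in> N \<omega>. (\<omega>, x) \<in> A}"
        using fin[OF that] sub[OF that] that
        by (subst card_Un_disjoint[symmetric]) (auto intro!: arg_cong[where f = card])
      then show ?thesis by (simp add: f_def)
    qed
    moreover have "(\<lambda>\<omega>. of_nat (card (N \<omega> \<inter> space L)) - f A \<omega>) \<in> borel_measurable M"
      using compl.IH cnt'[of "space L"] by measurable
    ultimately show ?case by (simp cong: measurable_cong)
  next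
    case (union A)
    have "f (\<Union>i. A i) \<omega> = (\<Sum>i. f (A i) \<omega>)" if "\<omega> \<in> space M" for \<omega>
    proof -
      let ?C = "count_space (N \<omega>)"
      have *: "f B \<omega> = emeasure ?C {x \<in> N \<omega>. (\<omega>, x) \<in> B}" for B
        using fin[OF that] by (simp add: f_def emeasure_count_space_finite)
      have "disjoint_family (\<lambda>i. {x \<in> N \<omega>. (\<omega>, x) \<in> A i})"
        using union(1) by (fastforce simp: disjoint_family_on_def)
      then have "(\<Sum>i. f (A i) \<omega>) = emeasure ?C (\<Union>i. {x \<in> N \<omega>. (\<omega>, x) \<in> A i})"
        unfolding * by (intro suminf_emeasure) auto
      also have "(\<Union>i. {x \<in> N \<omega>. (\<omega>, x) \<in> A i}) = {x \<in> N \<omega>. (\<omega>, x) \<in> (\<Union>i. A i)}"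
        by auto
      finally show ?thesis by (simp add: *)
    qed
    moreover have "(\<lambda>\<omega>. \<Sum>i. f (A i) \<omega>) \<in> borel_measurable M"
      using union.IH by measurable
    ultimately show ?case by (simp cong: measurable_cong)
  qed
  then show ?thesis by (simp add: f_def[abs_def])
qed

text \<open>Existence means a nonzero count in some ball, and within each ball the process is
  finite, so that the count of a random section is measurable.\<close>

lemma sets_Collect_bex_point_process:
  fixes N :: "'w \<Rightarrow> 'a::euclidean_space set"
  assumes fin: "\<And>\<omega> B. \<omega> \<in> space M \<Longrightarrow> bounded B \<Longrightarrow> finite (N \<omega> \<inter> B)"
    and cnt: "\<And>A. A \<in> sets borel \<Longrightarrow> bounded A \<Longrightarrow>
      (\<lambda>\<omega>. card (N \<omega> \<inter> A)) \<in> measurable M (count_space UNIV)"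
    and H: "{(\<omega>, x). \<omega> \<in> space M \<and> P \<omega> x} \<in> sets (M \<Otimes>\<^sub>M borel)"
  shows "{\<omega> \<in> space M. \<exists>x\<in>N \<omega>. P \<omega> x} \<in> sets M"
proof -
  let ?H = "{(\<omega>, x). \<omega> \<in> space M \<and> P \<omega> x}"
  let ?f = "\<lambda>n \<omega>. of_nat (card {x \<in> N \<omega> \<inter> cball 0 (real n). (\<omega>, x) \<in> ?H}) :: ennreal"
  have f [measurable]: "?f n \<in> borel_measurable M" for n
    by (rule borel_measurable_card_section[where L = borel])
      (use H in \<open>auto intro!: fin cnt simp: Int_assoc bounded_Int\<close>)
  have "{\<omega> \<in> space M. \<exists>x\<in>N \<omega>. P \<omega> x} = {\<omega> \<in> space M. \<exists>n. ?f n \<omega> \<noteq> 0}"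
  proof (rule Collect_cong, rule conj_cong[OF refl])
    fix \<omega> assume w: "\<omega> \<in> space M"
    have "?f n \<omega> \<noteq> 0 \<longleftrightarrow> (\<exists>x\<in>N \<omega>. norm x \<le> real n \<and> P \<omega> x)" for n
    proof -
      have "finite {x \<in> N \<omega> \<inter> cball 0 (real n). (\<omega>, x) \<in> ?H}"
        by (rule finite_subset[OF _ fin[OF w bounded_cball[of 0 "real n"]]]) auto
      then show ?thesis
        using w by (auto simp: card_eq_0_iff)
    qed
    then show "(\<exists>x\<in>N \<omega>. P \<omega> x) \<longleftrightarrow> (\<exists>n. ?f n \<omega> \<noteq> 0)"
      using real_arch_simple by blast
  qed
  also have "\<dots> \<in> sets M"
    by measurable
  finally show ?thesis .
qed

section \<open>Poisson processes and the parameter space of lines\<close>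

text \<open>Carries the definition over from subsets of \<open>S\<close> to all Borel sets: as the
  points lie in \<open>S\<close>, meeting \<open>A\<close> and meeting \<open>A \<inter> S\<close>
  are the same. The void probability is the Poisson weight at \<open>k = 0\<close>.\<close>

lemma homogeneous_poisson_processD:
  assumes "homogeneous_poisson_process M S c N" and S: "S \<in> sets borel"
  shows homogeneous_poisson_process_subset: "\<omega> \<in> space M \<Longrightarrow> N \<omega> \<subseteq> S"
    and homogeneous_poisson_process_finite:
      "\<omega> \<in> space M \<Longrightarrow> bounded B \<Longrightarrow> finite (N \<omega> \<inter> B)"
    and homogeneous_poisson_process_measurable:
      "A \<in> sets borel \<Longrightarrow> bounded A \<Longrightarrow>
        (\<lambda>\<omega>. card (N \<omega> \<inter> A)) \<in> measurable M (count_space UNIV)"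
    and homogeneous_poisson_process_void:
      "c \<ge> 0 \<Longrightarrow> A \<in> sets borel \<Longrightarrow> bounded A \<Longrightarrow>
        measure M {\<omega> \<in> space M. N \<omega> \<inter> A = {}} = exp (- (c * measure lborel (A \<inter> S)))"
proof -
  let ?L = "scale_measure (ennreal c) (restrict_space lborel S)"
  have P: "poisson_process M ?L N"
    using assms(1) by (simp add: homogeneous_poisson_process_def)
  show sub: "N \<omega> \<subseteq> S" if "\<omega> \<in> space M" for \<omega>
  proof -
    have "N \<omega> \<subseteq> space ?L"
      using that P unfolding poisson_process_def by blast
    then show ?thesis
      by (simp add: space_scale_measure space_restrict_space)
  qed
  show fin: "finite (N \<omega> \<inter> B)" if "\<omega> \<in> space M" "bounded B" for \<omega> B
    using that P by (auto simp: poisson_process_def)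
  have AS: "A \<inter> S \<in> sets ?L" if "A \<in> sets borel" for A
    using that S by (auto simp: sets_restrict_space)
  have eq: "N \<omega> \<inter> (A \<inter> S) = N \<omega> \<inter> A" if "\<omega> \<in> space M" for \<omega> A
    using sub[OF that] by auto
  {
    assume A: "A \<in> sets borel" "bounded A"
    then have "(\<lambda>\<omega>. card (N \<omega> \<inter> (A \<inter> S))) \<in> measurable M (count_space UNIV)"
      using P AS by (auto simp: poisson_process_def bounded_Int)
    then show "(\<lambda>\<omega>. card (N \<omega> \<inter> A)) \<in> measurable M (count_space UNIV)"
      by (simp add: eq cong: measurable_cong)
    assume c: "c \<ge> 0"
    have "measure M {\<omega> \<in> space M. card (N \<omega> \<inter> (A \<inter> S)) = 0} =
        exp (- measure ?L (A \<inter> S)) * measure ?L (A \<inter> S) ^ 0 / fact 0"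
      using P AS[OF A(1)] A by (auto simp: poisson_process_def bounded_Int simp del: card_0_eq)
    moreover have "card (N \<omega> \<inter> (A \<inter> S)) = 0 \<longleftrightarrow> N \<omega> \<inter> A = {}" if "\<omega> \<in> space M" for \<omega>
      using fin[OF that A(2)] by (simp add: eq[OF that])
    then have "{\<omega> \<in> space M. card (N \<omega> \<inter> (A \<inter> S)) = 0} = {\<omega> \<in> space M. N \<omega> \<inter> A = {}}"
      by blast
    moreover have "measure ?L (A \<inter> S) = c * measure lborel (A \<inter> S)"
      using c S by (simp add: measure_def emeasure_restrict_space enn2real_mult)
    ultimately show "measure M {\<omega> \<in> space M. N \<omega> \<inter> A = {}} =
        exp (- (c * measure lborel (A \<inter> S)))"
      by simp
  }
qed

lemma continuous_direction: "continuous_on S direction"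
proof -
  have *: "direction = (\<lambda>\<theta>. cos \<theta> *\<^sub>R axis 1 1 + sin \<theta> *\<^sub>R axis 2 1)"
    by (auto simp: direction_def vec_eq_iff forall_2 axis_def vector_2 fun_eq_iff)
  show ?thesis
    unfolding * by (intro continuous_intros)
qed

lemma sets_line_params: "line_params \<in> sets borel"
  unfolding line_params_def by (intro borel_Times) auto

text \<open>Angles and marks range over bounded intervals, so a bound on \<open>t\<close> suffices.
  By local finiteness, only finitely many lines then come within \<open>c\<close> of the
  origin.\<close>

lemma bounded_line_params: "bounded ({(\<theta>, t, z). t \<le> c} \<inter> line_params)"
proof -
  have "{(\<theta>, t, z). t \<le> c} \<inter> line_params \<subseteq> cbox (0, 0, 0) (2 * pi, c, 1)"
    by (auto simp: line_params_def cbox_Pair_eq)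
  then show ?thesis
    using bounded_subset bounded_cbox by blast
qed

section \<open>Approximation of points of a cylinder by a dense set\<close>

text \<open>Only finitely many cylinders near \<open>x\<close> miss it, and avoiding these closed
  sets is an open condition. As \<open>x\<close> may lie on the boundary of the given cylinder, it
  is first pushed into the interior. With fewer cylinders at \<open>y\<close>, the infimum there can
  only be larger.\<close>

lemma dense_point_fewer_cylinders:
  fixes x :: "real^2"
  assumes "r > 0" and X: "X \<subseteq> line_params" and fin: "\<And>B. bounded B \<Longrightarrow> finite (X \<inter> B)"
    and Q: "\<And>U. open U \<Longrightarrow> U \<noteq> {} \<Longrightarrow> \<exists>q\<in>Q. q \<in> U"
    and V: "open V" "x \<in> V" and x: "\<bar>x \<bullet> direction \<theta>\<^sub>0 - t\<^sub>0\<bar> \<le> r"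
  obtains y where "y \<in> Q" "y \<in> V" "\<bar>y \<bullet> direction \<theta>\<^sub>0 - t\<^sub>0\<bar> \<le> r"
    "\<forall>(\<theta>, t, z)\<in>X. \<bar>y \<bullet> direction \<theta> - t\<bar> \<le> r \<longrightarrow> \<bar>x \<bullet> direction \<theta> - t\<bar> \<le> r"
proof -
  \<comment> \<open>A cylinder meeting \<open>ball x 1\<close> has
    \<open>t \<le> norm x + 1 + r\<close>, so \<open>K\<close> catches every line that
    matters.\<close>
  define K where "K = {(\<theta>, t, z). t \<le> norm x + 1 + r} \<inter> line_params"
  define Z where "Z = {(\<theta>, t, z) \<in> X \<inter> K. r < \<bar>x \<bullet> direction \<theta> - t\<bar>}"
  define W where "W = V \<inter> ball x 1 \<inter> (\<Inter>(\<theta>, t, z)\<in>Z. {y. r < \<bar>y \<bullet> direction \<theta> - t\<bar>})"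
  have "finite Z"
    by (rule finite_subset[OF _ fin[OF bounded_line_params[of "norm x + 1 + r"]]])
      (auto simp: Z_def K_def)
  then have "open W"
    unfolding W_def using V
    by (intro open_Int open_INT open_ball) (auto intro!: open_Collect_less continuous_intros)
  moreover have "x \<in> W"
    using V by (auto simp: W_def Z_def)
  ultimately obtain e where e: "e > 0" "ball x e \<subseteq> W"
    using openE by blast
  define a where "a = x \<bullet> direction \<theta>\<^sub>0 - t\<^sub>0"
  \<comment> \<open>The shift below has length at most \<open>\<epsilon> * r\<close>; having
    \<open>r + 1\<close> in the denominator makes this strictly less than \<open>e\<close>.\<close>
  define \<epsilon> where "\<epsilon> = min 1 (e / (r + 1))"
  have \<epsilon>: "0 < \<epsilon>" "\<epsilon> \<le> 1" "\<epsilon> * (r + 1) \<le> e"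
    using e \<open>r > 0\<close> by (auto simp: \<epsilon>_def simp flip: pos_le_divide_eq)
  \<comment> \<open>Moving towards the line scales the signed distance \<open>a\<close> by
    \<open>1 - \<epsilon>\<close>, hence brings it strictly below \<open>r\<close> in absolute
    value.\<close>
  define w where "w = x - (\<epsilon> * a) *\<^sub>R direction \<theta>\<^sub>0"
  define U where "U = W \<inter> {y. \<bar>y \<bullet> direction \<theta>\<^sub>0 - t\<^sub>0\<bar> < r}"
  have "dist x w < e"
  proof -
    have "dist x w = \<epsilon> * \<bar>a\<bar>"
      using \<epsilon> by (simp add: w_def dist_norm abs_mult)
    also have "\<dots> \<le> \<epsilon> * r"
      using \<epsilon> x by (simp add: a_def)
    also have "\<dots> < e"
      using \<epsilon> by (simp add: algebra_simps)
    finally show ?thesis .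
  qed
  then have "w \<in> W"
    using e by auto
  moreover have "\<bar>w \<bullet> direction \<theta>\<^sub>0 - t\<^sub>0\<bar> < r"
  proof -
    have "w \<bullet> direction \<theta>\<^sub>0 - t\<^sub>0 = (1 - \<epsilon>) * a"
      by (simp add: w_def a_def inner_diff_left algebra_simps)
    then have "\<bar>w \<bullet> direction \<theta>\<^sub>0 - t\<^sub>0\<bar> = (1 - \<epsilon>) * \<bar>a\<bar>"
      using \<epsilon> by (simp add: abs_mult)
    also have "\<dots> \<le> (1 - \<epsilon>) * r"
      using \<epsilon> x by (intro mult_left_mono) (auto simp: a_def)
    also have "\<dots> < r"
      using \<epsilon> \<open>r > 0\<close> by (simp add: algebra_simps)
    finally show ?thesis .
  qed
  ultimately have "U \<noteq> {}"
    by (auto simp: U_def)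
  moreover have "open U"
    unfolding U_def using \<open>open W\<close>
    by (intro open_Int) (auto intro!: open_Collect_less continuous_intros)
  ultimately obtain y where y: "y \<in> Q" "y \<in> U"
    using Q by blast
  have "\<bar>x \<bullet> direction \<theta> - t\<bar> \<le> r"
    if p: "(\<theta>, t, z) \<in> X" and yt: "\<bar>y \<bullet> direction \<theta> - t\<bar> \<le> r" for \<theta> t z
  proof (rule ccontr)
    assume "\<not> \<bar>x \<bullet> direction \<theta> - t\<bar> \<le> r"
    moreover have "dist x y < 1"
      using y by (auto simp: U_def W_def)
    then have "norm y \<le> norm x + 1"
      using norm_triangle_ineq2[of y x] by (simp add: dist_norm norm_minus_commute)
    then have "t \<le> norm x + 1 + r"
      using yt Cauchy_Schwarz_ineq2[of y "direction \<theta>"] by simp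
    ultimately have "(\<theta>, t, z) \<in> Z"
      using p X by (auto simp: Z_def K_def)
    then show False
      using y yt by (auto simp: U_def W_def)
  qed
  then show ?thesis
    using y by (intro that[of y]) (auto simp: U_def W_def)
qed

section \<open>Borel-Cantelli for the values of distant lines\<close>

text \<open>The indicators of \<open>k < Y x\<close> sum to the number of naturals below
  \<open>Y x\<close>, which is at most \<open>\<bar>Y x\<bar> + 1\<close>; its finite expectation
  bounds all partial sums.\<close>

lemma (in prob_space) summable_prob_gt:
  assumes "integrable M Y"
  shows "summable (\<lambda>k. prob {x \<in> space M. real k < Y x})"
proof (rule summableI_nonneg_bounded)
  note [measurable] = borel_measurable_integrable[OF assms]
  fix n
  have "(\<Sum>k<n. prob {x \<in> space M. real k < Y x}) =
      (\<Sum>k<n. expectation (indicator {x \<in> space M. real k < Y x}))"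
    by simp
  also have "\<dots> = expectation (\<lambda>x. \<Sum>k<n. indicator {x \<in> space M. real k < Y x} x)"
    by (intro Bochner_Integration.integral_sum[symmetric]) (auto simp: emeasure_eq_measure)
  also have "\<dots> \<le> expectation (\<lambda>x. \<bar>Y x\<bar> + 1)"
  proof (intro integral_mono)
    fix x assume x: "x \<in> space M"
    have "(\<Sum>k<n. indicator {x \<in> space M. real k < Y x} x) = real (card {k. k < n \<and> real k < Y x})"
      using x by (simp add: indicator_def sum.If_cases Int_def)
    also have "card {k. k < n \<and> real k < Y x} \<le> card {..<nat \<lceil>Y x\<rceil>}"
      by (intro card_mono) (auto, linarith)
    then have "real (card {k. k < n \<and> real k < Y x}) \<le> \<bar>Y x\<bar> + 1"
      by simp linarith
    finally show "(\<Sum>k<n. indicator {x \<in> space M. real k < Y x} x) \<le> \<bar>Y x\<bar> + 1" .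
  qed (use assms in \<open>auto simp: emeasure_eq_measure intro!: Bochner_Integration.integrable_sum\<close>)
  finally show "(\<Sum>k<n. prob {x \<in> space M. real k < Y x}) \<le> expectation (\<lambda>x. \<bar>Y x\<bar> + 1)" .
qed simp

text \<open>The terms are the probabilities of \<open>k < 2 * x + r\<close> under \<open>D\<close>,
  and \<open>2 * x + r\<close> is integrable. Up to a constant factor they are the volumes of the
  parameter boxes used for Borel-Cantelli.\<close>

lemma summable_cdf_tail:
  assumes "real_distribution D" and "integrable D (\<lambda>x. x)"
  shows "summable (\<lambda>k. 1 - cdf D ((real k - r) / 2))"
proof -
  interpret D: real_distribution D by fact
  have "1 - cdf D ((real k - r) / 2) = D.prob {x \<in> space D. real k < 2 * x + r}" for k
  proof -
    have "{x \<in> space D. real k < 2 * x + r} = space D - {..(real k - r) / 2}"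
      by (auto simp: field_simps)
    then show ?thesis
      by (simp add: cdf_def D.prob_compl[symmetric])
  qed
  then show ?thesis
    using D.summable_prob_gt[of "\<lambda>x. 2 * x + r"] assms(2) by simp
qed

text \<open>The inequality \<open>z \<le> cdf D s\<close> bounds the value of the line by
  \<open>s\<close>. Distant lines obey it by Borel-Cantelli; the finitely many others have marks
  below 1 and obey it once \<open>s\<close> is large.\<close>

lemma AE_eventually_small_values:
  assumes "prob_space M" and "real_distribution D" and "integrable D (\<lambda>x. x)" and "u > 0"
    and X: "homogeneous_poisson_process M line_params u X"
  shows "AE \<omega> in M. \<exists>n::nat. \<forall>(\<theta>, t, z)\<in>X \<omega>. \<forall>s\<ge>real n. t \<le> 2 * s + r \<longrightarrow> z \<le> cdf D s"
proof -
  interpret prob_space M by fact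
  interpret D: real_distribution D by fact
  let ?F = "cdf D"
  note sub = homogeneous_poisson_process_subset[OF X sets_line_params]
  note fin = homogeneous_poisson_process_finite[OF X sets_line_params]
  note cnt = homogeneous_poisson_process_measurable[OF X sets_line_params]
  have F: "?F s \<le> 1" "0 \<le> ?F s" for s
    by (auto simp: D.cdf_bounded_prob D.cdf_nonneg)
  have mono: "?F s \<le> ?F t" if "s \<le> t" for s t
    using D.cdf_nondecreasing that by blast
  have void: "prob {\<omega> \<in> space M. X \<omega> \<inter> A \<noteq> {}} \<le> u * measure lborel A"
    and ev: "{\<omega> \<in> space M. X \<omega> \<inter> A \<noteq> {}} \<in> events"
    if A: "A = cbox a b" for A a b
  proof -
    have "(\<lambda>\<omega>. card (X \<omega> \<inter> A)) -` (- {0}) \<inter> space M \<in> events"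
      by (rule measurable_sets[OF cnt]) (auto simp: A bounded_cbox)
    also have "(\<lambda>\<omega>. card (X \<omega> \<inter> A)) -` (- {0}) \<inter> space M = {\<omega> \<in> space M. X \<omega> \<inter> A \<noteq> {}}"
      using fin bounded_cbox[of a b] by (auto simp: A)
    finally show *: "{\<omega> \<in> space M. X \<omega> \<inter> A \<noteq> {}} \<in> events" .
    have "space M - {\<omega> \<in> space M. X \<omega> \<inter> A \<noteq> {}} = {\<omega> \<in> space M. X \<omega> \<inter> A = {}}"
      by auto
    then have "prob {\<omega> \<in> space M. X \<omega> \<inter> A \<noteq> {}} = 1 - prob {\<omega> \<in> space M. X \<omega> \<inter> A = {}}"
      using prob_compl[OF *] by simp
    also have "\<dots> = 1 - exp (- (u * measure lborel (A \<inter> line_params)))"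
      using homogeneous_poisson_process_void[OF X sets_line_params, of A] \<open>u > 0\<close>
      by (simp add: A bounded_cbox)
    also have "\<dots> \<le> u * measure lborel (A \<inter> line_params)"
      using exp_ge_add_one_self[of "- (u * measure lborel (A \<inter> line_params))"] by simp
    also have "\<dots> \<le> u * measure lborel A"
      using \<open>u > 0\<close> emeasure_lborel_cbox_finite[of a b]
      by (intro mult_left_mono measure_mono_fmeasurable)
        (auto simp: A fmeasurable_def sets_line_params)
    finally show "prob {\<omega> \<in> space M. X \<omega> \<inter> A \<noteq> {}} \<le> u * measure lborel A" .
  qed
  \<comment> \<open>A line with \<open>k \<le> t \<le> k + 1\<close> and \<open>t < 2 * quantile F z + r\<close> has its parameters in \<open>T k\<close>.\<close>
  define T where "T k = cbox (0, real k, ?F ((real k - r) / 2)) (2 * pi, real k + 1, 1)" for k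
  have "measure lborel (T k) = 2 * pi * (1 - ?F ((real k - r) / 2))" for k
    using F by (simp add: T_def measure_lborel_cbox_eq Basis_prod_def inner_prod_def
      prod.union_disjoint prod.reindex)
  then have le: "prob {\<omega> \<in> space M. X \<omega> \<inter> T k \<noteq> {}} \<le>
      u * (2 * pi * (1 - ?F ((real k - r) / 2)))" for k
    using void[OF T_def[of k]] by simp
  have "summable (\<lambda>k. prob {\<omega> \<in> space M. X \<omega> \<inter> T k \<noteq> {}})"
    by (rule summable_comparison_test'[where N = 0,
          OF summable_mult[OF summable_mult[OF summable_cdf_tail[OF assms(2,3)]]]])
      (use le in \<open>simp\<close>)
  then have "AE \<omega> in M. \<forall>\<^sub>F k in sequentially. \<omega> \<in> space M - {\<omega> \<in> space M. X \<omega> \<inter> T k \<noteq> {}}"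
    using ev[OF T_def] by (intro borel_cantelli_AE1) (auto simp: emeasure_eq_measure)
  \<comment> \<open>Marks equal to 1 are excluded because the quantile may be infinite there; such
    parameters fill degenerate boxes of volume 0.\<close>
  moreover have "AE \<omega> in M. \<forall>k::nat. X \<omega> \<inter> cbox (0, 0, 1) (2 * pi, real k, 1) = {}"
  proof (subst AE_all_countable, intro allI)
    fix k :: nat
    let ?A = "cbox (0, 0, 1::real) (2 * pi, real k, 1)"
    have "prob {\<omega> \<in> space M. X \<omega> \<inter> ?A \<noteq> {}} \<le> u * measure lborel ?A"
      by (rule void[OF refl])
    also have "measure lborel ?A = 0"
      by (simp add: measure_lborel_cbox_eq Basis_prod_def inner_prod_def
        prod.union_disjoint prod.reindex)
    finally have "emeasure M {\<omega> \<in> space M. X \<omega> \<inter> ?A \<noteq> {}} = 0"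
      by (simp add: emeasure_eq_measure measure_le_0_iff)
    then show "AE \<omega> in M. X \<omega> \<inter> ?A = {}"
      using ev[OF refl] by (intro AE_I[where N = "{\<omega> \<in> space M. X \<omega> \<inter> ?A \<noteq> {}}"]) auto
  qed
  moreover note AE_space
  ultimately show ?thesis
  proof eventually_elim
    case (elim \<omega>)
    then obtain k\<^sub>0 where k\<^sub>0: "X \<omega> \<inter> T k = {}" if "k \<ge> k\<^sub>0" for k
      by (auto simp: eventually_sequentially)
    have lt1: "z < 1" if "(\<theta>, t, z) \<in> X \<omega>" for \<theta> t z
    proof -
      obtain k :: nat where "t \<le> real k"
        using real_arch_simple by blast
      then have "(\<theta>, t, z) \<notin> cbox (0, 0, 1) (2 * pi, real k, 1)"
        using elim(2) that by blast
      then show ?thesis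
        using sub[OF elim(3)] that \<open>t \<le> real k\<close> by (force simp: cbox_Pair_eq line_params_def)
    qed
    have "\<exists>n::nat. \<forall>m\<ge>n. snd (snd p) \<le> ?F (real m)" if "p \<in> X \<omega>" for p
    proof -
      have "eventually (\<lambda>s. snd (snd p) < ?F s) at_top"
        using that by (intro order_tendstoD[OF D.cdf_lim_at_top_prob] lt1[of "fst p" "fst (snd p)"]) simp
      then have "eventually (\<lambda>m. snd (snd p) < ?F (real m)) sequentially"
        using filterlim_real_sequentially by (rule eventually_compose_filterlim)
      then show ?thesis
        by (fastforce simp: eventually_sequentially)
    qed
    then obtain n where n: "snd (snd p) \<le> ?F (real m)" if "p \<in> X \<omega>" "m \<ge> n p" for p and m :: nat
      by metis
    let ?K = "X \<omega> \<inter> ({(\<theta>, t, z). t \<le> real k\<^sub>0} \<inter> line_params)"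
    have finK: "finite ?K"
      by (rule fin[OF elim(3) bounded_line_params])
    \<comment> \<open>The element 0 keeps \<open>Max\<close> meaningful when \<open>?K\<close> is
      empty.\<close>
    define m where "m = Max (insert 0 (n ` ?K))"
    show ?case
    proof (intro exI[of _ m], clarify)
      fix \<theta> t z s assume p: "(\<theta>, t, z) \<in> X \<omega>" and s: "real m \<le> s" "t \<le> 2 * s + r"
      have lp: "(\<theta>, t, z) \<in> line_params"
        using sub[OF elim(3)] p by blast
      show "z \<le> ?F s"
      proof (cases "t \<le> real k\<^sub>0")
        case True
        then have "n (\<theta>, t, z) \<le> m"
          unfolding m_def using p lp finK by (intro Max_ge) auto
        then have "z \<le> ?F (real m)"
          using n[OF p] by simp
        then show ?thesis
          using mono[OF s(1)] by simp
      next
        case False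
        \<comment> \<open>The index of a box whose distance range contains \<open>t\<close>; from
          \<open>k \<le> t \<le> 2 * s + r\<close> it follows that
          \<open>(k - r) / 2 \<le> s\<close>.\<close>
        define k where "k = nat \<lfloor>t\<rfloor>"
        have k: "real k \<le> t" "t \<le> real k + 1" "k \<ge> k\<^sub>0"
          using False by (auto simp: k_def) linarith+
        then have "(\<theta>, t, z) \<notin> T k"
          using k\<^sub>0 p by blast
        \<comment> \<open>The line meets every other constraint of \<open>T k\<close>, so the lower
          bound on the mark must fail.\<close>
        then have "z < ?F ((real k - r) / 2)"
          using k lp by (auto simp: T_def cbox_Pair_eq line_params_def)
        also have "\<dots> \<le> ?F s"
          using k s by (intro mono) simp
        finally show ?thesis by simp
      qed
    qed
  qed
qed

section \<open>Measurability of the occupation event\<close>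

text \<open>Occupation is an existence statement over \<eta> whose condition contains existence
  statements over \<open>X\<close>. The measurability of such statements is applied to
  \<open>X\<close> on the product with the plane, then to \<eta> on \<open>M\<close>.\<close>

lemma sets_occupied:
  assumes X: "homogeneous_poisson_process M line_params u X"
    and \<eta>: "homogeneous_poisson_process M UNIV lam \<eta>"
    and "mono F"
  shows "{\<omega> \<in> space M. 0 \<in> occupied (\<eta> \<omega>) (cyl_field F r (marked_lines (X \<omega>)))} \<in> sets M"
proof -
  have dir [measurable]: "direction \<in> borel_measurable borel"
    by (rule borel_measurable_continuous_onI[OF continuous_direction])
  have [measurable]: "(\<lambda>p. fst p) \<in> measurable (borel :: (real \<times> real \<times> real) measure) borel"
    "(\<lambda>p. fst (snd p)) \<in> measurable (borel :: (real \<times> real \<times> real) measure) borel"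
    "(\<lambda>p. snd (snd p)) \<in> measurable (borel :: (real \<times> real \<times> real) measure) borel"
    by (intro borel_measurable_continuous_onI continuous_intros)+
  define I where "I x p \<longleftrightarrow> \<bar>x \<bullet> direction (fst p) - fst (snd p)\<bar> \<le> r"
    for x and p :: "real \<times> real \<times> real"
  \<comment> \<open>By \<open>quantile_less_iff\<close> the rational condition says that
    \<open>p\<close> has value below \<open>norm x\<close>, so such a line keeps the disc at
    \<open>x\<close> from reaching the origin.\<close>
  define J where "J x p \<longleftrightarrow> I x p \<and>
    (\<exists>q. real_of_rat q < norm x \<and> snd (snd p) \<le> F (real_of_rat q))" for x and p :: "real \<times> real \<times> real"
  let ?MX = "M \<Otimes>\<^sub>M (borel :: (real^2) measure)"
  have I [measurable]: "Measurable.pred (?MX \<Otimes>\<^sub>M borel) (\<lambda>((\<omega>, x), p). I x p)"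
    unfolding I_def split_beta' by measurable
  have J [measurable]: "Measurable.pred (?MX \<Otimes>\<^sub>M borel) (\<lambda>((\<omega>, x), p). J x p)"
    using I unfolding J_def split_beta' by measurable
  \<comment> \<open>The process is lifted to pairs \<open>(\<omega>, x)\<close>, on which it depends
    through \<open>\<omega>\<close> alone, so that the location \<open>x\<close> may enter the
    predicate.\<close>
  have ex: "{w \<in> space ?MX. \<exists>p\<in>X (fst w). P (snd w) p} \<in> sets ?MX"
    if "Measurable.pred (?MX \<Otimes>\<^sub>M borel) (\<lambda>((\<omega>, x), p). P x p)" for P
  proof (rule sets_Collect_bex_point_process)
    have "{(w, p). w \<in> space ?MX \<and> P (snd w) p} =
        {v \<in> space (?MX \<Otimes>\<^sub>M borel). case v of ((\<omega>, x), p) \<Rightarrow> P x p}"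
      by (auto simp: space_pair_measure)
    then show "{(w, p). w \<in> space ?MX \<and> P (snd w) p} \<in> sets (?MX \<Otimes>\<^sub>M borel)"
      using that by (simp add: pred_def split_beta')
  qed (auto simp: space_pair_measure
      intro!: homogeneous_poisson_process_finite[OF X sets_line_params]
        measurable_compose[OF measurable_fst
          homogeneous_poisson_process_measurable[OF X sets_line_params]])
  define H where "H \<omega> x \<longleftrightarrow>
    (if \<exists>p\<in>X \<omega>. I x p then \<not> (\<exists>p\<in>X \<omega>. J x p) else norm x \<le> 0)" for \<omega> x
  have "{\<omega> \<in> space M. \<exists>x\<in>\<eta> \<omega>. H \<omega> x} \<in> sets M"
  proof (rule sets_Collect_bex_point_process)
    have [measurable]: "Measurable.pred ?MX (\<lambda>w. \<exists>p\<in>X (fst w). I (snd w) p)"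
      "Measurable.pred ?MX (\<lambda>w. \<exists>p\<in>X (fst w). J (snd w) p)"
      using ex[OF I] ex[OF J] by (simp_all add: pred_def)
    have "{w \<in> space ?MX. H (fst w) (snd w)} \<in> sets ?MX"
      unfolding H_def by measurable
    then show "{(\<omega>, x). \<omega> \<in> space M \<and> H \<omega> x} \<in> sets ?MX"
      by (simp add: space_pair_measure split_beta' mem_Times_iff)
  qed (auto intro: homogeneous_poisson_process_finite[OF \<eta>]
      homogeneous_poisson_process_measurable[OF \<eta>])
  moreover have "(\<exists>x\<in>\<eta> \<omega>. H \<omega> x) \<longleftrightarrow>
      0 \<in> occupied (\<eta> \<omega>) (cyl_field F r (marked_lines (X \<omega>)))" for \<omega>
  proof -
    have "J x p \<longleftrightarrow> I x p \<and> \<not> ereal (norm x) \<le> quantile F (snd (snd p))" for x p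
      by (simp add: J_def not_le quantile_less_iff[OF \<open>mono F\<close>])
    then have "H \<omega> x \<longleftrightarrow> ereal (norm x) \<le> cyl_field F r (marked_lines (X \<omega>)) x" for x
      unfolding le_cyl_field_iff H_def I_def split_beta by auto
    then show ?thesis
      by (simp add: occupied_def ereal_disc_def)
  qed
  ultimately show ?thesis
    by simp
qed

section \<open>A deterministic criterion for vacancy\<close>

text \<open>A disc covering the origin has its centre \<open>x\<close> outside the ball, so its
  radius is positive and some cylinder contains \<open>x\<close>. A nearby \<open>y\<close> in
  \<open>Q\<close> lies in a cylinder but in no additional one, so its value is at least
  \<open>norm x > norm y / 2\<close>, against \<open>small\<close>.\<close>

lemma not_occupied:
  assumes "r > 0" and X: "X \<subseteq> line_params" and fin: "\<And>B. bounded B \<Longrightarrow> finite (X \<inter> B)"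
    and Q: "\<And>U. open U \<Longrightarrow> U \<noteq> {} \<Longrightarrow> \<exists>q\<in>Q. q \<in> U"
    and small: "\<And>y. y \<in> Q \<Longrightarrow> n < norm y \<Longrightarrow>
      cyl_field F r (marked_lines X) y \<le> ereal (norm y / 2)"
    and H: "H \<inter> cball 0 n = {}" and "n \<ge> 0"
  shows "0 \<notin> occupied H (cyl_field F r (marked_lines X))"
proof
  let ?\<phi> = "cyl_field F r (marked_lines X)"
  assume "0 \<in> occupied H ?\<phi>"
  then obtain x where x: "x \<in> H" "ereal (norm x) \<le> ?\<phi> x"
    by (auto simp: occupied_def ereal_disc_def)
  have n: "n < norm x"
    using H x(1) by (force simp: disjoint_iff)
  then have hit: "\<exists>(\<theta>, t, z)\<in>X. \<bar>x \<bullet> direction \<theta> - t\<bar> \<le> r"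
    using x(2) \<open>n \<ge> 0\<close> by (auto simp: le_cyl_field_iff split: if_splits)
  then obtain \<theta>\<^sub>0 t\<^sub>0 z\<^sub>0 where p: "(\<theta>\<^sub>0, t\<^sub>0, z\<^sub>0) \<in> X" "\<bar>x \<bullet> direction \<theta>\<^sub>0 - t\<^sub>0\<bar> \<le> r"
    by blast
  \<comment> \<open>The upper bound on \<open>norm y\<close> provides the gap
    \<open>norm y / 2 < norm x\<close> on which the contradiction rests.\<close>
  have V: "open {y :: real^2. n < norm y \<and> norm y < 2 * norm x}"
    by (intro open_Collect_conj open_Collect_less continuous_intros)
  have xV: "x \<in> {y. n < norm y \<and> norm y < 2 * norm x}"
    using n \<open>n \<ge> 0\<close> by auto
  obtain y where y: "y \<in> Q" "n < norm y" "norm y < 2 * norm x"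
    "\<bar>y \<bullet> direction \<theta>\<^sub>0 - t\<^sub>0\<bar> \<le> r"
    "\<forall>(\<theta>, t, z)\<in>X. \<bar>y \<bullet> direction \<theta> - t\<bar> \<le> r \<longrightarrow> \<bar>x \<bullet> direction \<theta> - t\<bar> \<le> r"
  proof (rule dense_point_fewer_cylinders[OF \<open>r > 0\<close> X _ _ V xV p(2)])
    show "finite (X \<inter> B)" if "bounded B" for B
      using that by (rule fin)
    show "\<exists>q\<in>Q. q \<in> U" if "open U" "U \<noteq> {}" for U
      using that by (rule Q)
  qed simp
  have "ereal (norm x) \<le> ?\<phi> y"
    using x(2) y(4,5) p hit unfolding le_cyl_field_iff by (auto split: if_splits)
  also have "?\<phi> y \<le> ereal (norm y / 2)"
    using y by (intro small) auto
  finally show False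
    using y(3) by simp
qed

section \<open>Independence and positive probability of vacancy\<close>

theorem proposition7:
  fixes M :: "'w measure"
    and D :: "real measure"
    and u r lam :: real
    and X :: "'w \<Rightarrow> (real \<times> real \<times> real) set"
    and \<eta> :: "'w \<Rightarrow> (real^2) set"
    and \<phi> :: "'w \<Rightarrow> real^2 \<Rightarrow> ereal"
  assumes "prob_space M"
    and "real_distribution D" and "AE x in D. 0 \<le> x" and "integrable D (\<lambda>x. x)"
    and "u > 0" and "r > 0" and "lam > 0"
    and "homogeneous_poisson_process M line_params u X"
    and "\<And>\<omega>. \<phi> \<omega> = cyl_field (cdf D) r (marked_lines (X \<omega>))"
    and "homogeneous_poisson_process M UNIV lam \<eta>"
    and "indep_process_field M \<eta> \<phi>"
  shows "{\<omega> \<in> space M. 0 \<in> occupied (\<eta> \<omega>) (\<phi> \<omega>)} \<in> sets M \<and>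
         measure M {\<omega> \<in> space M. 0 \<in> occupied (\<eta> \<omega>) (\<phi> \<omega>)} < 1"
proof -
  interpret prob_space M by fact
  interpret D: real_distribution D by fact
  note X = assms(8) and \<phi> = assms(9) and \<eta> = assms(10)
  have mono: "mono (cdf D)"
    by (auto intro: monoI D.cdf_nondecreasing)
  let ?O = "{\<omega> \<in> space M. 0 \<in> occupied (\<eta> \<omega>) (\<phi> \<omega>)}"
  have O: "?O \<in> events"
    unfolding \<phi> by (rule sets_occupied[OF X \<eta> mono])
  obtain Q :: "(real^2) set" where "countable Q"
    and Q: "\<And>U. open U \<Longrightarrow> U \<noteq> {} \<Longrightarrow> \<exists>q\<in>Q. q \<in> U"
    using countable_dense_exists by metis
  \<comment> \<open>Quantifying over the countable set \<open>Q\<close> places \<open>G n\<close> in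
    the sigma-algebra generated by the field, where independence from \<open>E n\<close> is
    available.\<close>
  define G where "G n = {\<omega> \<in> space M. \<forall>y\<in>Q. real n < norm y \<longrightarrow> \<phi> \<omega> y \<le> ereal (norm y / 2)}" for n
  define E where "E n = {\<omega> \<in> space M. \<eta> \<omega> \<inter> cball 0 (real n) = {}}" for n
  let ?\<B> = "{A :: (real^2) set. A \<in> sets borel \<and> bounded A}"
  let ?S\<eta> = "vimage_algebra (space M) (\<lambda>\<omega>. \<lambda>A\<in>?\<B>. card (\<eta> \<omega> \<inter> A)) (\<Pi>\<^sub>M A\<in>?\<B>. count_space UNIV)"
  let ?S\<phi> = "vimage_algebra (space M) \<phi> (\<Pi>\<^sub>M x\<in>UNIV. borel)"
  have ind: "indep_set (sets ?S\<eta>) (sets ?S\<phi>)"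
    using assms(11) unfolding indep_process_field_def .
  have G: "G n \<in> sets ?S\<phi>" for n
  proof -
    have "\<phi> \<in> measurable ?S\<phi> (\<Pi>\<^sub>M x\<in>UNIV. borel)"
      by (rule measurable_vimage_algebra1) (auto simp: space_PiM)
    then have [measurable]: "(\<lambda>\<omega>. \<phi> \<omega> y) \<in> borel_measurable ?S\<phi>" for y
      by (rule measurable_compose[OF _ measurable_component_singleton]) simp
    have "{\<omega> \<in> space ?S\<phi>. \<forall>y\<in>Q. real n < norm y \<longrightarrow> \<phi> \<omega> y \<le> ereal (norm y / 2)} \<in> sets ?S\<phi>"
      by (intro sets.sets_Collect_countable_All' \<open>countable Q\<close>) measurable
    then show ?thesis
      by (simp add: G_def)
  qed
  have E: "E n \<in> sets ?S\<eta>" for n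
  proof -
    have "(\<lambda>\<omega>. \<lambda>A\<in>?\<B>. card (\<eta> \<omega> \<inter> A)) \<in> measurable ?S\<eta> (\<Pi>\<^sub>M A\<in>?\<B>. count_space UNIV)"
      by (rule measurable_vimage_algebra1) (auto simp: space_PiM)
    then have "(\<lambda>\<omega>. (\<lambda>A\<in>?\<B>. card (\<eta> \<omega> \<inter> A)) (cball 0 (real n))) \<in> measurable ?S\<eta> (count_space UNIV)"
      by (rule measurable_compose[OF _ measurable_component_singleton]) simp
    then have "(\<lambda>\<omega>. card (\<eta> \<omega> \<inter> cball 0 (real n))) \<in> measurable ?S\<eta> (count_space UNIV)"
      by simp
    then have "(\<lambda>\<omega>. card (\<eta> \<omega> \<inter> cball 0 (real n))) -` {0} \<inter> space ?S\<eta> \<in> sets ?S\<eta>"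
      by (rule measurable_sets) simp
    also have "(\<lambda>\<omega>. card (\<eta> \<omega> \<inter> cball 0 (real n))) -` {0} \<inter> space ?S\<eta> = E n"
      using homogeneous_poisson_process_finite[OF \<eta>] by (auto simp: E_def disjoint_iff)
    finally show ?thesis .
  qed
  \<comment> \<open>Independence includes that both sigma-algebras consist of events.\<close>
  have sub: "sets ?S\<phi> \<subseteq> events"
    using ind unfolding indep_set_def indep_sets_def by (auto split: bool.splits)
  have AE_G: "AE \<omega> in M. \<exists>n. \<omega> \<in> G n"
    using AE_eventually_small_values[OF assms(1,2,4,5) X, of r] AE_space
  proof eventually_elim
    case (elim \<omega>)
    then obtain n :: nat where n: "z \<le> cdf D s"
      if "(\<theta>, t, z) \<in> X \<omega>" "s \<ge> real n" "t \<le> 2 * s + r" for \<theta> t z s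
      by blast
    \<comment> \<open>Beyond radius \<open>2 * n\<close> the level \<open>norm y / 2\<close> exceeds
      the threshold \<open>n\<close>.\<close>
    have "\<phi> \<omega> y \<le> ereal (norm y / 2)" if y: "real (2 * n) < norm y" for y
    proof (rule ccontr)
      assume "\<not> \<phi> \<omega> y \<le> ereal (norm y / 2)"
      then have "ereal (norm y / 2) < cyl_field (cdf D) r (marked_lines (X \<omega>)) y"
        by (simp add: \<phi>)
      \<comment> \<open>A real \<open>s\<close> in between brings the strict inequality into the
        form of \<open>le_cyl_field_iff\<close>; its positivity rules out the value 0 off the
        cylinders.\<close>
      then obtain s where s: "norm y / 2 < s"
        and "ereal s < cyl_field (cdf D) r (marked_lines (X \<omega>)) y"
        using ereal_dense2 by fastforce
      then have "ereal s \<le> cyl_field (cdf D) r (marked_lines (X \<omega>)) y"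
        by (simp only: less_imp_le)
      moreover have "s > 0"
        using norm_ge_zero[of y] s by linarith
      ultimately obtain \<theta> t z where p: "(\<theta>, t, z) \<in> X \<omega>" "\<bar>y \<bullet> direction \<theta> - t\<bar> \<le> r"
        "ereal s \<le> quantile (cdf D) z"
        by (auto simp: le_cyl_field_iff split: if_splits)
      \<comment> \<open>This reads \<open>t \<le> 2 * (norm y / 2) + r\<close>, as required for the
        bound at level \<open>norm y / 2\<close>.\<close>
      have "t \<le> norm y + r"
        using p(2) Cauchy_Schwarz_ineq2[of y "direction \<theta>"] by simp
      then have "z \<le> cdf D (norm y / 2)"
        using y by (intro n[OF p(1)]) auto
      then have "quantile (cdf D) z \<le> ereal (norm y / 2)"
        by (auto simp: quantile_def intro: INF_lower)
      then have "ereal s \<le> ereal (norm y / 2)"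
        using p(3) by (rule order_trans[rotated])
      then show False
        using s by simp
    qed
    then have "\<omega> \<in> G (2 * n)"
      using elim(2) by (simp add: G_def)
    then show ?case ..
  qed
  \<comment> \<open>Countably many events covering almost every outcome cannot all be null.\<close>
  have "\<exists>n. prob (G n) \<noteq> 0"
  proof (rule ccontr)
    assume "\<nexists>n. prob (G n) \<noteq> 0"
    then have "AE \<omega> in M. \<omega> \<notin> G n" for n
      using G sub by (intro AE_not_in) (auto simp: null_sets_def emeasure_eq_measure)
    then have "AE \<omega> in M. \<forall>n. \<omega> \<notin> G n"
      by (simp add: AE_all_countable)
    with AE_G have "AE \<omega> in M. False"
      by eventually_elim simp
    then show False
      by simp
  qed
  then obtain n where n: "prob (G n) > 0"
    by (auto simp: zero_less_measure_iff)
  have "prob (E n) = exp (- (lam * measure lborel (cball (0 :: real^2) (real n))))"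
    using homogeneous_poisson_process_void[OF \<eta>, of "cball 0 (real n)"] \<open>lam > 0\<close>
    by (simp add: E_def)
  then have "0 < prob (E n) * prob (G n)"
    using n by simp
  also have "\<dots> = prob (E n \<inter> G n)"
    by (rule indep_setD[OF ind E G, symmetric])
  also have "\<dots> \<le> prob (space M - ?O)"
  proof (rule finite_measure_mono)
    show "E n \<inter> G n \<subseteq> space M - ?O"
    proof safe
      fix \<omega> assume w: "\<omega> \<in> E n" "\<omega> \<in> G n" and "\<omega> \<in> space M"
        and occ: "0 \<in> occupied (\<eta> \<omega>) (\<phi> \<omega>)"
      have "0 \<notin> occupied (\<eta> \<omega>) (cyl_field (cdf D) r (marked_lines (X \<omega>)))"
        using homogeneous_poisson_processD(1,2)[OF X sets_line_params \<open>\<omega> \<in> space M\<close>] w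
        by (intro not_occupied[OF \<open>r > 0\<close> _ _ Q, where n = "real n"])
          (auto simp: E_def G_def \<phi>)
      then show False
        using occ by (simp add: \<phi>)
    qed (auto simp: E_def)
  qed (use O in auto)
  also have "\<dots> = 1 - prob ?O"
    by (rule prob_compl[OF O])
  finally show ?thesis
    using O by simp
qed

end
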